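(* For every positive integer $c$ there exists a rational Lie algebra $\mathfrak{n}^{\mathbb{Q}}$ of nilpotency class $c$ and an Anosov automorphism $f:\mathfrak{n}^{\mathbb{Q}}\to\mathfrak{n}^{\mathbb{Q}}$ with $\min(\mathrm{sg}(f))=c$.
   Context: The lower central series is $\gamma_1(\mathfrak{n})=\mathfrak{n}$, $\gamma_i(\mathfrak{n})=[\mathfrak{n},\gamma_{i-1}(\mathfrak{n})]$; $\mathfrak{n}$ has nilpotency class $c$ if $\gamma_{c+1}(\mathfrak{n})=0\neq\gamma_c(\mathfrak{n})$. An automorphism of a rational Lie algebra is Anosov if it is hyperbolic (no eigenvalue of absolute value $1$) and integer-like (characteristic polynomial with integer coefficients and determinant $\pm1$). Its signature $\mathrm{sg}(f)$ is the set $\{p,q\}$ with $p$ the number of eigenvalues (with multiplicity) of absolute value $<1$ and $q$ the number of absolute value $>1$. *)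

theory Defs
  imports "Jordan_Normal_Form.Char_Poly"
begin

text \<open>A finite-dimensional rational Lie algebra is modelled as Q^n (carrier_vec n)
  with a bracket br.\<close>

definition lie_algebra :: "nat \<Rightarrow> (rat vec \<Rightarrow> rat vec \<Rightarrow> rat vec) \<Rightarrow> bool" where
  "lie_algebra n br \<longleftrightarrow>
     (\<forall>x\<in>carrier_vec n. \<forall>y\<in>carrier_vec n. br x y \<in> carrier_vec n) \<and>
     (\<forall>x\<in>carrier_vec n. \<forall>y\<in>carrier_vec n. \<forall>z\<in>carrier_vec n.
         br (x + y) z = br x z + br y z \<and> br z (x + y) = br z x + br z y) \<and>
     (\<forall>a::rat. \<forall>x\<in>carrier_vec n. \<forall>y\<in>carrier_vec n.
         br (a \<cdot>\<^sub>v x) y = a \<cdot>\<^sub>v br x y \<and> br x (a \<cdot>\<^sub>v y) = a \<cdot>\<^sub>v br x y) \<and>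
     (\<forall>x\<in>carrier_vec n. br x x = 0\<^sub>v n) \<and>
     (\<forall>x\<in>carrier_vec n. \<forall>y\<in>carrier_vec n. \<forall>z\<in>carrier_vec n.
         br x (br y z) + br y (br z x) + br z (br x y) = 0\<^sub>v n)"

inductive_set lin_span :: "nat \<Rightarrow> rat vec set \<Rightarrow> rat vec set" for n S where
  zero: "0\<^sub>v n \<in> lin_span n S"
| base: "x \<in> S \<Longrightarrow> x \<in> lin_span n S"
| add: "x \<in> lin_span n S \<Longrightarrow> y \<in> lin_span n S \<Longrightarrow> x + y \<in> lin_span n S"
| smult: "x \<in> lin_span n S \<Longrightarrow> a \<cdot>\<^sub>v x \<in> lin_span n S"

text \<open>Lower central series: lcs n br 1 = whole algebra,
  lcs n br (i+1) = [n, lcs n br i].  (lcs n br 0 is also the whole algebra, unused.)\<close>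
fun lcs :: "nat \<Rightarrow> (rat vec \<Rightarrow> rat vec \<Rightarrow> rat vec) \<Rightarrow> nat \<Rightarrow> rat vec set" where
  "lcs n br 0 = carrier_vec n"
| "lcs n br (Suc 0) = carrier_vec n"
| "lcs n br (Suc (Suc i)) =
     lin_span n {br x y | x y. x \<in> carrier_vec n \<and> y \<in> lcs n br (Suc i)}"

definition nilpotency_class :: "nat \<Rightarrow> (rat vec \<Rightarrow> rat vec \<Rightarrow> rat vec) \<Rightarrow> nat \<Rightarrow> bool" where
  "nilpotency_class n br c \<longleftrightarrow> lcs n br (c + 1) = {0\<^sub>v n} \<and> lcs n br c \<noteq> {0\<^sub>v n}"

definition lie_automorphism :: "nat \<Rightarrow> (rat vec \<Rightarrow> rat vec \<Rightarrow> rat vec) \<Rightarrow> rat mat \<Rightarrow> bool" where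
  "lie_automorphism n br A \<longleftrightarrow> A \<in> carrier_mat n n \<and> det A \<noteq> 0 \<and>
     (\<forall>x\<in>carrier_vec n. \<forall>y\<in>carrier_vec n. A *\<^sub>v br x y = br (A *\<^sub>v x) (A *\<^sub>v y))"

definition eigenvalues_C :: "rat mat \<Rightarrow> complex multiset" where
  "eigenvalues_C A = proots (map_poly (of_rat :: rat \<Rightarrow> complex) (char_poly A))"

definition hyperbolic :: "rat mat \<Rightarrow> bool" where
  "hyperbolic A \<longleftrightarrow> (\<forall>z \<in># eigenvalues_C A. cmod z \<noteq> 1)"

definition integer_like :: "rat mat \<Rightarrow> bool" where
  "integer_like A \<longleftrightarrow> (\<forall>i. coeff (char_poly A) i \<in> \<int>) \<and> (det A = 1 \<or> det A = -1)"

definition anosov_aut :: "nat \<Rightarrow> (rat vec \<Rightarrow> rat vec \<Rightarrow> rat vec) \<Rightarrow> rat mat \<Rightarrow> bool" where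
  "anosov_aut n br A \<longleftrightarrow> lie_automorphism n br A \<and> hyperbolic A \<and> integer_like A"

definition signature :: "rat mat \<Rightarrow> nat set" where
  "signature A = {size (filter_mset (\<lambda>z. cmod z < 1) (eigenvalues_C A)),
                  size (filter_mset (\<lambda>z. cmod z > 1) (eigenvalues_C A))}"

end

theory Submission
  imports Defs
begin

text \<open>
  Let F = Q(s) with s^2 = 2 and K = F(x) with x^2 = x + 1, and let \<open>area\<close> be the determinant
  form of the F-plane K with basis (1, x). On the layers K, F, K, ..., K (of weights 1, 2, 3, ..., c)
  put the bracket K x K \<rightarrow> F given by \<open>area\<close>, and let layer 1 act on all higher layers by
  multiplication in K. The Jacobi identity amounts to
  u area(v,w) + v area(w,u) + w area(u,v) = 0 and to commutativity of K, and the class is c.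

  The unit l = 1 + s x has relative norm n = s - 1 over F. Multiplication by l on layer 1 and by
  l^(k-2) n on layer k \<ge> 2 is an automorphism, integral in the basis (1, s, x, s x). The
  conjugates of l are approximately 3.29, 0.13, -1.29, 1.87, so every layer has precisely one
  eigenvalue of modulus less than 1, namely the one belonging to the conjugate 0.13 of l; on a
  layer k \<ge> 3 the delicate eigenvalue is 3.29^(k-2) (sqrt 2 - 1), which exceeds 1.
\<close>

section \<open>The ring K and its units\<close>

text \<open>\<open>BQ a b c d\<close> stands for a + b s + c x + d s x, where s^2 = 2 and x^2 = x + 1.\<close>

datatype biquad = BQ (q0: rat) (q1: rat) (q2: rat) (q3: rat)

lemma biquad_eq_iff:
  "x = y \<longleftrightarrow> q0 x = q0 y \<and> q1 x = q1 y \<and> q2 x = q2 y \<and> q3 x = q3 y"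
  by (cases x; cases y) auto

instantiation biquad :: comm_ring_1
begin

definition "0 = BQ 0 0 0 0"
definition "1 = BQ 1 0 0 0"
definition "x + y = BQ (q0 x + q0 y) (q1 x + q1 y) (q2 x + q2 y) (q3 x + q3 y)"
definition "x - y = BQ (q0 x - q0 y) (q1 x - q1 y) (q2 x - q2 y) (q3 x - q3 y)"
definition "- x = BQ (- q0 x) (- q1 x) (- q2 x) (- q3 x)"
definition "x * y = BQ
  (q0 x * q0 y + 2 * q1 x * q1 y + q2 x * q2 y + 2 * q3 x * q3 y)
  (q0 x * q1 y + q1 x * q0 y + q2 x * q3 y + q3 x * q2 y)
  (q0 x * q2 y + q2 x * q0 y + 2 * q1 x * q3 y + 2 * q3 x * q1 y + q2 x * q2 y + 2 * q3 x * q3 y)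
  (q0 x * q3 y + q3 x * q0 y + q1 x * q2 y + q2 x * q1 y + q2 x * q3 y + q3 x * q2 y)"

instance
  by standard
    (simp_all add: biquad_eq_iff zero_biquad_def one_biquad_def plus_biquad_def minus_biquad_def
      uminus_biquad_def times_biquad_def algebra_simps)

end

lemmas biquad_defs = zero_biquad_def one_biquad_def plus_biquad_def minus_biquad_def
  uminus_biquad_def times_biquad_def

lemma biquad_sel_zero_one [simp]:
  "q2 0 = 0" "q3 0 = 0" "q2 1 = 0" "q3 1 = 0"
  by (simp_all add: biquad_defs)

text \<open>Writing the arguments as a + b x and c + d x with coefficients in F, this is a d - b c.\<close>

definition area :: "biquad \<Rightarrow> biquad \<Rightarrow> biquad" where
  "area x y = BQ (q0 x * q2 y + 2 * q1 x * q3 y - q2 x * q0 y - 2 * q3 x * q1 y)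
     (q0 x * q3 y + q1 x * q2 y - q2 x * q1 y - q3 x * q0 y) 0 0"

definition biquad_of_rat :: "rat \<Rightarrow> biquad" where "biquad_of_rat a = BQ a 0 0 0"

definition lam :: biquad where "lam = BQ 1 0 0 1"
definition lam_norm :: biquad where "lam_norm = BQ (-1) 1 0 0"

lemma area_add: "area (x + y) z = area x z + area y z" "area z (x + y) = area z x + area z y"
  by (simp_all add: area_def biquad_defs algebra_simps)

lemma area_biquad_of_rat:
  "area (biquad_of_rat a * x) y = biquad_of_rat a * area x y"
  "area x (biquad_of_rat a * y) = biquad_of_rat a * area x y"
  by (simp_all add: area_def biquad_of_rat_def biquad_defs algebra_simps)

lemma area_self: "area x x = 0"
  by (simp add: area_def biquad_defs algebra_simps)

lemma area_zero: "area 0 x = 0" "area x 0 = 0"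
  by (simp_all add: area_def biquad_defs)

text \<open>Multiplication by \<open>lam\<close> is F-linear on the plane K, so it scales the
  determinant form by its determinant, the relative norm of \<open>lam\<close>.\<close>

lemma area_lam: "area (lam * x) (lam * y) = lam_norm * area x y"
  by (simp add: area_def lam_def lam_norm_def biquad_defs algebra_simps)

text \<open>The left side is F-trilinear and alternating in three vectors of a plane, hence
  zero.\<close>

lemma area_cyclic: "x * area y z + y * area z x + z * area x y = 0"
  by (simp add: area_def biquad_defs algebra_simps)

text \<open>Block m > 0 has weight m + 2. Block 0 is exceptional because its weight is 1; the
  general formula at m = 0 would give the multiplier of F, the layer of weight 2.\<close>

definition layer_unit :: "nat \<Rightarrow> biquad" where
  "layer_unit m = (if m = 0 then lam else lam ^ m * lam_norm)"

definition coord :: "biquad \<Rightarrow> nat \<Rightarrow> rat" where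
  "coord x i = [q0 x, q1 x, q2 x, q3 x] ! i"

definition basis_elem :: "nat \<Rightarrow> biquad" where
  "basis_elem j = BQ (of_bool (j = 0)) (of_bool (j = 1)) (of_bool (j = 2)) (of_bool (j = 3))"

section \<open>The Lie algebra\<close>

definition lie_dim :: "nat \<Rightarrow> nat" where "lie_dim r = 4*r+2"

text \<open>Coordinates 0 and 1 hold the layer F; the coordinates from 4m + 2 to 4m + 5 hold the m-th
  copy of K, which has weight 1 for m = 0 and weight m + 2 for m > 0. With r copies the class is
  r + 1; in particular, for r = 0 only the abelian algebra F remains.\<close>

definition comp_F :: "rat vec \<Rightarrow> biquad" where
  "comp_F v = BQ (v $ 0) (v $ 1) 0 0"

text \<open>With default 0, \<open>comp_K r v 0\<close> makes sense for r = 0 too, where there is no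
  layer 1 and the bracket is to vanish.\<close>

definition comp_K :: "nat \<Rightarrow> rat vec \<Rightarrow> nat \<Rightarrow> biquad" where
  "comp_K r v m = (if m < r then BQ (v $ (4*m+2)) (v $ (4*m+3)) (v $ (4*m+4)) (v $ (4*m+5)) else 0)"

definition vec_of_comps :: "nat \<Rightarrow> biquad \<Rightarrow> (nat \<Rightarrow> biquad) \<Rightarrow> rat vec" where
  "vec_of_comps r a f = vec (lie_dim r) (\<lambda>i. if i < 2 then coord a i
     else coord (f ((i-2) div 4)) ((i-2) mod 4))"

lemma vec_of_comps_carrier [simp]: "vec_of_comps r a f \<in> carrier_vec (lie_dim r)"
  by (simp add: vec_of_comps_def)

text \<open>Coordinates 0 and 1 record only \<open>q0\<close> and \<open>q1\<close>, so
  \<open>a\<close> has to lie in F.\<close>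

lemma comp_F_vec_of_comps: "q2 a = 0 \<Longrightarrow> q3 a = 0 \<Longrightarrow> comp_F (vec_of_comps r a f) = a"
  by (simp add: comp_F_def vec_of_comps_def coord_def lie_dim_def biquad_eq_iff)

lemma vec_of_comps_index:
  assumes "m < r" "k < 4" "i = 4*m+2+k"
  shows "vec_of_comps r a f $ i = coord (f m) k"
proof -
  have "i < lie_dim r" "\<not> i < 2" "(i-2) div 4 = m" "(i-2) mod 4 = k"
    using assms unfolding lie_dim_def by auto
  then show ?thesis by (simp add: vec_of_comps_def)
qed

lemma comp_K_vec_of_comps: "comp_K r (vec_of_comps r a f) m = (if m < r then f m else 0)"
proof (cases "m < r")
  case True
  have "vec_of_comps r a f $ (4*m+2) = coord (f m) 0" "vec_of_comps r a f $ (4*m+3) = coord (f m) 1"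
    "vec_of_comps r a f $ (4*m+4) = coord (f m) 2" "vec_of_comps r a f $ (4*m+5) = coord (f m) 3"
    by (rule vec_of_comps_index[OF True]; simp)+
  with True show ?thesis
    by (simp only: comp_K_def biquad_eq_iff) (simp add: coord_def)
qed (simp add: comp_K_def)

lemma block_index_cases:
  assumes "i < lie_dim r"
  obtains "i = 0" | "i = 1" | m k where "m < r" "k < 4" "i = 4*m+2+k"
proof (cases "i < 2")
  case True
  then show ?thesis using that(1,2) by linarith
next
  case False
  show ?thesis
  proof (rule that(3))
    show "(i-2) div 4 < r" using assms False unfolding lie_dim_def by linarith
    show "i = 4*((i-2) div 4) + 2 + (i-2) mod 4" using False by presburger
  qed simp
qed

lemma less4_cases:
  assumes "(k::nat) < 4"
  obtains "k = 0" | "k = 1" | "k = 2" | "k = 3"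
  using assms by linarith

lemma comp_eqI:
  assumes "v \<in> carrier_vec (lie_dim r)" "w \<in> carrier_vec (lie_dim r)"
    and "comp_F v = comp_F w" "\<And>m. m < r \<Longrightarrow> comp_K r v m = comp_K r w m"
  shows "v = w"
proof (rule eq_vecI)
  fix i assume "i < dim_vec w"
  then have "i < lie_dim r" using assms(2) by simp
  then show "v $ i = w $ i"
  proof (cases rule: block_index_cases)
    case (3 m k)
    have "v $ (4*m+2) = w $ (4*m+2)" "v $ (4*m+3) = w $ (4*m+3)"
      "v $ (4*m+4) = w $ (4*m+4)" "v $ (4*m+5) = w $ (4*m+5)"
      using assms(4)[OF 3(1)] 3(1) unfolding comp_K_def by auto
    moreover have "i = 4*m+2 \<or> i = 4*m+3 \<or> i = 4*m+4 \<or> i = 4*m+5"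
      using 3(2,3) by linarith
    ultimately show ?thesis by blast
  qed (use assms(3) in \<open>simp_all add: comp_F_def\<close>)
qed (use assms in auto)

lemma comp_add:
  assumes "v \<in> carrier_vec (lie_dim r)" "w \<in> carrier_vec (lie_dim r)"
  shows "comp_F (v + w) = comp_F v + comp_F w" "comp_K r (v + w) m = comp_K r v m + comp_K r w m"
  using assms by (simp_all add: lie_dim_def comp_F_def comp_K_def biquad_defs)

lemma comp_smult:
  assumes "v \<in> carrier_vec (lie_dim r)"
  shows "comp_F (a \<cdot>\<^sub>v v) = biquad_of_rat a * comp_F v"
    "comp_K r (a \<cdot>\<^sub>v v) m = biquad_of_rat a * comp_K r v m"
  using assms by (simp_all add: lie_dim_def comp_F_def comp_K_def biquad_of_rat_def biquad_defs)

lemma comp_zero: "comp_F (0\<^sub>v (lie_dim r)) = 0" "comp_K r (0\<^sub>v (lie_dim r)) m = 0"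
  by (simp_all add: lie_dim_def comp_F_def comp_K_def biquad_defs)

text \<open>The component of weight m + 1 (for m > 0), which bracketing with layer 1 moves into block m.\<close>

fun prev_comp :: "nat \<Rightarrow> rat vec \<Rightarrow> nat \<Rightarrow> biquad" where
  "prev_comp r v 0 = 0"
| "prev_comp r v (Suc 0) = comp_F v"
| "prev_comp r v (Suc (Suc m)) = comp_K r v (Suc m)"

definition bracket :: "nat \<Rightarrow> rat vec \<Rightarrow> rat vec \<Rightarrow> rat vec" where
  "bracket r v w = vec_of_comps r (area (comp_K r v 0) (comp_K r w 0))
     (\<lambda>m. comp_K r v 0 * prev_comp r w m - comp_K r w 0 * prev_comp r v m)"

lemma bracket_carrier [simp]: "bracket r v w \<in> carrier_vec (lie_dim r)"
  by (simp add: bracket_def)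

lemma comp_F_bracket: "comp_F (bracket r v w) = area (comp_K r v 0) (comp_K r w 0)"
  unfolding bracket_def by (rule comp_F_vec_of_comps) (simp_all add: area_def)

lemma comp_K_bracket:
  "m < r \<Longrightarrow> comp_K r (bracket r v w) m =
    comp_K r v 0 * prev_comp r w m - comp_K r w 0 * prev_comp r v m"
  by (simp add: bracket_def comp_K_vec_of_comps)

lemma comp_K_bracket_0 [simp]: "comp_K r (bracket r v w) 0 = 0"
  by (simp add: bracket_def comp_K_vec_of_comps)

lemma prev_comp_add:
  assumes "v \<in> carrier_vec (lie_dim r)" "w \<in> carrier_vec (lie_dim r)"
  shows "prev_comp r (v + w) m = prev_comp r v m + prev_comp r w m"
  using assms by (cases "(r,v,m)" rule: prev_comp.cases) (simp_all add: comp_add)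

lemma prev_comp_smult:
  assumes "v \<in> carrier_vec (lie_dim r)"
  shows "prev_comp r (a \<cdot>\<^sub>v v) m = biquad_of_rat a * prev_comp r v m"
  using assms by (cases "(r,v,m)" rule: prev_comp.cases) (simp_all add: comp_smult)

text \<open>Brackets have no component in layer 1, which settles F and block 0. Block 1, of weight
  3, is \<open>area_cyclic\<close>; in the higher blocks the terms cancel by commutativity of
  K.\<close>

lemma bracket_jacobi:
  assumes [simp]: "x \<in> carrier_vec (lie_dim r)" "y \<in> carrier_vec (lie_dim r)"
    "z \<in> carrier_vec (lie_dim r)"
  shows "bracket r x (bracket r y z) + bracket r y (bracket r z x)
      + bracket r z (bracket r x y) = 0\<^sub>v (lie_dim r)"
proof (rule comp_eqI)
  fix m assume m: "m < r"
  \<comment> \<open>For m = 0 the truncated m - 1 is again 0, and both sides vanish.\<close>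
  have p: "prev_comp r (bracket r a b) m = (if m = 1 then area (comp_K r a 0) (comp_K r b 0)
      else comp_K r a 0 * prev_comp r b (m-1) - comp_K r b 0 * prev_comp r a (m-1))" for a b
    using m by (cases "(r,a,m)" rule: prev_comp.cases) (simp_all add: comp_F_bracket comp_K_bracket)
  show "comp_K r (bracket r x (bracket r y z) + bracket r y (bracket r z x)
      + bracket r z (bracket r x y)) m =
      comp_K r (0\<^sub>v (lie_dim r)) m"
    using m area_cyclic[of "comp_K r x 0" "comp_K r y 0" "comp_K r z 0"]
    by (simp add: comp_add[where r = r] comp_zero[where r = r] comp_K_bracket p algebra_simps)
qed (simp_all add: comp_add[where r = r] comp_zero[where r = r] comp_F_bracket area_zero)

lemma bracket_lie_algebra: "lie_algebra (lie_dim r) (bracket r)"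
  unfolding lie_algebra_def
proof (intro conjI ballI allI)
  fix x y z :: "rat vec" and a :: rat
  assume [simp]: "x \<in> carrier_vec (lie_dim r)" "y \<in> carrier_vec (lie_dim r)"
  show "bracket r x y \<in> carrier_vec (lie_dim r)" by simp
  show "bracket r (a \<cdot>\<^sub>v x) y = a \<cdot>\<^sub>v bracket r x y" "bracket r x (a \<cdot>\<^sub>v y) = a \<cdot>\<^sub>v bracket r x y"
    by (rule comp_eqI[where r = r];
      simp add: comp_smult[where r = r] comp_F_bracket comp_K_bracket area_biquad_of_rat
        prev_comp_smult algebra_simps)+
  show "bracket r x x = 0\<^sub>v (lie_dim r)"
    by (rule comp_eqI[where r = r];
      simp add: comp_zero[where r = r] comp_F_bracket comp_K_bracket area_self)
  assume [simp]: "z \<in> carrier_vec (lie_dim r)"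
  show "bracket r (x + y) z = bracket r x z + bracket r y z"
    "bracket r z (x + y) = bracket r z x + bracket r z y"
    by (rule comp_eqI[where r = r];
      simp add: comp_add[where r = r] comp_F_bracket comp_K_bracket area_add
        prev_comp_add algebra_simps)+
  show "bracket r x (bracket r y z) + bracket r y (bracket r z x)
      + bracket r z (bracket r x y) = 0\<^sub>v (lie_dim r)"
    by (rule bracket_jacobi) simp_all
qed

section \<open>Nilpotency\<close>

text \<open>For m > 0, \<open>prev_comp r v m\<close> is the component of weight m + 1, so the last
  clause kills the weights from 2 to k - 1. Block 0 is invisible to \<open>prev_comp\<close> and
  needs its own clause.\<close>

definition weight_ge :: "nat \<Rightarrow> nat \<Rightarrow> rat vec set" where
  "weight_ge r k = {v \<in> carrier_vec (lie_dim r).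
     (2 \<le> k \<longrightarrow> comp_K r v 0 = 0) \<and> (\<forall>m. Suc m < k \<longrightarrow> prev_comp r v m = 0)}"

lemma prev_comp_zero: "prev_comp r (0\<^sub>v (lie_dim r)) m = 0"
  by (cases "(r, 0\<^sub>v (lie_dim r) :: rat vec, m)" rule: prev_comp.cases) (simp_all add: comp_zero)

text \<open>For k > 0 the vector \<open>y\<close> has no layer 1 part, so only layer 1 of
  \<open>x\<close> acts, raising weights by one. For k = 0 it is enough that brackets have no layer
  1 part.\<close>

lemma bracket_weight_ge:
  assumes "y \<in> weight_ge r (Suc k)"
  shows "bracket r x y \<in> weight_ge r (Suc (Suc k))"
proof -
  have "prev_comp r (bracket r x y) m = 0" if "m < Suc k" for m
    using assms that
    by (cases "(r, x, m)" rule: prev_comp.cases)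
      (auto simp: weight_ge_def bracket_def comp_F_vec_of_comps area_zero comp_K_vec_of_comps)
  then show ?thesis by (simp add: weight_ge_def)
qed

lemma lin_span_weight_ge:
  assumes "S \<subseteq> weight_ge r k"
  shows "lin_span (lie_dim r) S \<subseteq> weight_ge r k"
proof
  fix v assume "v \<in> lin_span (lie_dim r) S"
  then show "v \<in> weight_ge r k"
    by induction
      (use assms in \<open>auto simp: weight_ge_def comp_zero prev_comp_zero comp_add prev_comp_add
        comp_smult prev_comp_smult\<close>)
qed

lemma lcs_weight_ge: "lcs (lie_dim r) (bracket r) (Suc k) \<subseteq> weight_ge r (Suc k)"
proof (induction k)
  case 0
  show ?case by (auto simp: weight_ge_def)
next
  case (Suc k)
  have "{bracket r x y |x y. x \<in> carrier_vec (lie_dim r) \<and> y \<in> lcs (lie_dim r) (bracket r) (Suc k)}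
      \<subseteq> weight_ge r (Suc (Suc k))"
    using Suc bracket_weight_ge by blast
  then show ?case
    unfolding lcs.simps by (rule lin_span_weight_ge)
qed

text \<open>The last block, m = r - 1, has weight r + 1. For r = 0 this would fail, since the only
  layer F has weight 2.\<close>

lemma weight_ge_top:
  assumes "0 < r" "v \<in> weight_ge r (Suc (Suc r))"
  shows "v = 0\<^sub>v (lie_dim r)"
proof (rule comp_eqI)
  have p: "prev_comp r v m = 0" if "m \<le> r" for m
    using assms(2) that by (simp add: weight_ge_def)
  show "comp_F v = comp_F (0\<^sub>v (lie_dim r))"
    using p[of 1] assms(1) by (simp add: comp_zero)
  fix m assume "m < r"
  then show "comp_K r v m = comp_K r (0\<^sub>v (lie_dim r)) m"
    using p[of "Suc m"] assms(2) by (cases m) (auto simp: comp_zero weight_ge_def)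
qed (use assms in \<open>auto simp: weight_ge_def\<close>)

lemma bracket_in_lcs:
  assumes "x \<in> carrier_vec n" "y \<in> lcs n br (Suc k)"
  shows "br x y \<in> lcs n br (Suc (Suc k))"
  unfolding lcs.simps using assms by (blast intro: lin_span.base)

lemma zero_in_lcs: "0\<^sub>v n \<in> lcs n br k"
  by (cases "(n, br, k)" rule: lcs.cases) (auto intro: lin_span.zero)

text \<open>The element 1 of the layer of weight m + 1: in F for m = 1, in block m - 1 for m > 1.
  The condition 1 \<le> i keeps block 0 empty when m = 1.\<close>

definition chain_vec :: "nat \<Rightarrow> nat \<Rightarrow> rat vec" where
  "chain_vec r m = vec_of_comps r (if m = 1 then 1 else 0) (\<lambda>i. if 1 \<le> i \<and> Suc i = m then 1 else 0)"

lemma comp_K_chain_vec: "comp_K r (chain_vec r m) i = (if i < r \<and> 1 \<le> i \<and> Suc i = m then 1 else 0)"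
  by (simp add: chain_vec_def comp_K_vec_of_comps)

lemma prev_comp_chain_vec:
  assumes "1 \<le> m" "m \<le> r"
  shows "prev_comp r (chain_vec r m) i = (if i = m then 1 else 0)"
  using assms
  by (cases "(r, chain_vec r m, i)" rule: prev_comp.cases)
    (auto simp: chain_vec_def comp_K_vec_of_comps comp_F_vec_of_comps)

text \<open>The first vector is a bracket of two elements of layer 1; bracketing with the 1 of layer
  1 then moves the entry 1 up one layer at a time.\<close>

lemma chain_vec_in_lcs:
  assumes "m < r"
  shows "chain_vec r (Suc m) \<in> lcs (lie_dim r) (bracket r) (Suc (Suc m))"
  using assms
proof (induction m)
  case 0
  let ?x = "vec_of_comps r 0 (\<lambda>i. if i = 0 then 1 else 0)"
  \<comment> \<open>\<open>BQ 0 0 1 0\<close> is the generator x of K; the pair 1, x has area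
    1.\<close>
  let ?y = "vec_of_comps r 0 (\<lambda>i. if i = 0 then BQ 0 0 1 0 else 0)"
  have p: "prev_comp r (vec_of_comps r 0 (\<lambda>i. if i = 0 then a else 0)) i = 0" for a i
    by (cases "(r, vec_of_comps r 0 (\<lambda>i. if i = 0 then a else 0), i)" rule: prev_comp.cases)
      (auto simp: comp_K_vec_of_comps comp_F_vec_of_comps)
  have "area 1 (BQ 0 0 1 0) = 1"
    by (simp add: area_def one_biquad_def)
  then have "chain_vec r 1 = bracket r ?x ?y"
    by (intro comp_eqI[where r = r])
      (use 0 in \<open>auto simp: comp_F_bracket comp_K_bracket p chain_vec_def comp_K_vec_of_comps comp_F_vec_of_comps\<close>)
  then show ?case using bracket_in_lcs[of ?x "lie_dim r" ?y "bracket r" 0] by simp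
next
  case (Suc m)
  let ?x = "vec_of_comps r 0 (\<lambda>i. if i = 0 then 1 else 0)"
  have "chain_vec r (Suc (Suc m)) = bracket r ?x (chain_vec r (Suc m))"
  proof (rule comp_eqI[where r = r])
    show "comp_F (chain_vec r (Suc (Suc m))) = comp_F (bracket r ?x (chain_vec r (Suc m)))"
      by (simp add: comp_F_bracket chain_vec_def comp_F_vec_of_comps comp_K_vec_of_comps area_zero)
    fix i assume "i < r"
    then show "comp_K r (chain_vec r (Suc (Suc m))) i = comp_K r (bracket r ?x (chain_vec r (Suc m))) i"
      using Suc.prems by (auto simp: comp_K_bracket prev_comp_chain_vec comp_K_vec_of_comps comp_K_chain_vec)
  qed (simp_all add: chain_vec_def)
  moreover have "chain_vec r (Suc m) \<in> lcs (lie_dim r) (bracket r) (Suc (Suc m))"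
    using Suc by simp
  ultimately show ?case using bracket_in_lcs[OF vec_of_comps_carrier] by metis
qed

lemma bracket_nilpotency_class: "nilpotency_class (lie_dim r) (bracket r) (Suc r)"
proof (cases "r = 0")
  case True
  have "bracket 0 x y = 0\<^sub>v (lie_dim 0)" for x y
    by (rule comp_eqI[where r = 0])
      (simp_all add: comp_F_bracket comp_zero[where r = 0] comp_K_def area_zero)
  then have "{bracket 0 x y |x y. x \<in> carrier_vec (lie_dim 0) \<and> y \<in> lcs (lie_dim 0) (bracket 0) (Suc 0)}
      \<subseteq> {0\<^sub>v (lie_dim 0)}" by blast
  moreover have "v = 0\<^sub>v n" if "v \<in> lin_span n S" "S \<subseteq> {0\<^sub>v n}" for v n S
    using that by induction auto
  ultimately have "lcs (lie_dim 0) (bracket 0) (Suc (Suc 0)) \<subseteq> {0\<^sub>v (lie_dim 0)}"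
    unfolding lcs.simps(3) by blast
  moreover have "vec_of_comps 0 1 (\<lambda>_. 0) \<noteq> 0\<^sub>v (lie_dim 0)"
  proof
    assume "vec_of_comps 0 1 (\<lambda>_. 0) = 0\<^sub>v (lie_dim 0)"
    then have "comp_F (vec_of_comps 0 1 (\<lambda>_. 0)) = 0" by (simp only: comp_zero)
    then show False by (simp add: comp_F_vec_of_comps)
  qed
  moreover have "vec_of_comps 0 1 (\<lambda>_. 0) \<in> lcs (lie_dim 0) (bracket 0) (Suc 0)"
    by simp
  ultimately show ?thesis
    unfolding nilpotency_class_def True Suc_eq_plus1[symmetric]
    using zero_in_lcs[of "lie_dim 0" "bracket 0" "Suc (Suc 0)"] by blast
next
  case False
  then obtain m where m: "r = Suc m" using not0_implies_Suc by blast
  have "lcs (lie_dim r) (bracket r) (Suc (Suc r)) = {0\<^sub>v (lie_dim r)}"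
    using weight_ge_top lcs_weight_ge[of r "Suc r"] zero_in_lcs[of "lie_dim r" "bracket r" "Suc (Suc r)"] False
    by blast
  moreover have "chain_vec r r \<in> lcs (lie_dim r) (bracket r) (Suc r)"
    using chain_vec_in_lcs[of m r] m by simp
  moreover have "chain_vec r r \<noteq> 0\<^sub>v (lie_dim r)"
    using prev_comp_chain_vec[of r r r] prev_comp_zero[of r r] False by auto
  ultimately show ?thesis unfolding nilpotency_class_def Suc_eq_plus1[symmetric] by blast
qed

section \<open>The automorphism\<close>

text \<open>The entry type is left open because the same shape serves the rational automorphism and
  its real diagonalization.\<close>

definition block_mat :: "nat \<Rightarrow> (nat \<Rightarrow> nat \<Rightarrow> 'a) \<Rightarrow> (nat \<Rightarrow> nat \<Rightarrow> nat \<Rightarrow> 'a) \<Rightarrow> 'a::zero mat" where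
  "block_mat r P Q = mat (lie_dim r) (lie_dim r) (\<lambda>(i,j).
     if i < 2 \<and> j < 2 then P i j
     else if 2 \<le> i \<and> 2 \<le> j \<and> (i-2) div 4 = (j-2) div 4
     then Q ((i-2) div 4) ((i-2) mod 4) ((j-2) mod 4) else 0)"

lemma block_mat_carrier [simp]: "block_mat r P Q \<in> carrier_mat (lie_dim r) (lie_dim r)"
  by (simp add: block_mat_def)

lemma block_mat_mult_F:
  fixes P :: "nat \<Rightarrow> nat \<Rightarrow> 'a::comm_ring_1"
  assumes u: "u \<in> carrier_vec (lie_dim r)" and i: "i < 2"
  shows "(block_mat r P Q *\<^sub>v u) $ i = P i 0 * u $ 0 + P i 1 * u $ 1"
proof -
  have il: "i < lie_dim r" using i by (simp add: lie_dim_def)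
  have "(block_mat r P Q *\<^sub>v u) $ i = (\<Sum>j\<in>{0..<lie_dim r}. block_mat r P Q $$ (i,j) * u $ j)"
    using u il by (simp add: block_mat_def scalar_prod_def)
  also have "\<dots> = (\<Sum>j\<in>{0,1}. block_mat r P Q $$ (i,j) * u $ j)"
    by (rule sum.mono_neutral_right) (use i il in \<open>auto simp: block_mat_def lie_dim_def\<close>)
  also have "\<dots> = P i 0 * u $ 0 + P i 1 * u $ 1"
    using i by (simp add: block_mat_def lie_dim_def)
  finally show ?thesis .
qed

lemma sum_less4: "(\<Sum>l<4. f l) = f 0 + f 1 + f 2 + f (3::nat)"
  by (simp add: eval_nat_numeral)

lemma block_mat_mult_K:
  fixes P :: "nat \<Rightarrow> nat \<Rightarrow> 'a::comm_ring_1"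
  assumes u: "u \<in> carrier_vec (lie_dim r)" and m: "m < r" and k: "k < 4" and i: "i = 4*m+2+k"
  shows "(block_mat r P Q *\<^sub>v u) $ i =
    Q m k 0 * u $ (4*m+2) + Q m k 1 * u $ (4*m+3) + Q m k 2 * u $ (4*m+4) + Q m k 3 * u $ (4*m+5)"
proof -
  have il: "i < lie_dim r" "\<not> i < 2" "(i-2) div 4 = m" "(i-2) mod 4 = k"
    using m k i unfolding lie_dim_def by auto
  have entry: "block_mat r P Q $$ (i,j) =
      (if 2 \<le> j \<and> (j-2) div 4 = m then Q m k ((j-2) mod 4) else 0)" if "j < lie_dim r" for j
    using that il by (auto simp: block_mat_def)
  have blk: "block_mat r P Q $$ (i, j) = Q m k l" if "l < 4" "j = 4*m+2+l" for j l
  proof -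
    have "j < lie_dim r" "2 \<le> j" "(j-2) div 4 = m" "(j-2) mod 4 = l"
      using m that unfolding lie_dim_def by auto
    then show ?thesis by (simp add: entry)
  qed
  have "(block_mat r P Q *\<^sub>v u) $ i = (\<Sum>j\<in>{0..<lie_dim r}. block_mat r P Q $$ (i,j) * u $ j)"
    using u il by (simp add: block_mat_def scalar_prod_def)
  also have "\<dots> = (\<Sum>j\<in>(\<lambda>l. 4*m+2+l) ` {..<4}. block_mat r P Q $$ (i,j) * u $ j)"
  proof (rule sum.mono_neutral_right)
    show "(\<lambda>l. 4*m+2+l) ` {..<4} \<subseteq> {0..<lie_dim r}" using m by (auto simp: lie_dim_def)
    show "\<forall>j\<in>{0..<lie_dim r} - (\<lambda>l. 4*m+2+l) ` {..<4}. block_mat r P Q $$ (i,j) * u $ j = 0"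
    proof
      fix j assume j: "j \<in> {0..<lie_dim r} - (\<lambda>l. 4*m+2+l) ` {..<4}"
      have "\<not> (2 \<le> j \<and> (j-2) div 4 = m)"
      proof
        assume "2 \<le> j \<and> (j-2) div 4 = m"
        then have "j = 4*m+2 + (j-2) mod 4"
          using mult_div_mod_eq[of 4 "j-2"] by linarith
        then have "j \<in> (\<lambda>l. 4*m+2+l) ` {..<4}" by (rule image_eqI) simp
        with j show False by blast
      qed
      then show "block_mat r P Q $$ (i,j) * u $ j = 0" using j by (auto simp: entry)
    qed
  qed simp
  also have "\<dots> = (\<Sum>l<4. block_mat r P Q $$ (i, 4*m+2+l) * u $ (4*m+2+l))"
    by (subst sum.reindex) (simp_all add: inj_on_def)
  also have "\<dots> = (\<Sum>l<4. Q m k l * u $ (4*m+2+l))"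
    by (rule sum.cong) (simp_all only: blk lessThan_iff)
  also have "\<dots> = Q m k 0 * u $ (4*m+2+0) + Q m k 1 * u $ (4*m+2+1) + Q m k 2 * u $ (4*m+2+2)
      + Q m k 3 * u $ (4*m+2+3)"
    by (rule sum_less4)
  finally show ?thesis unfolding add.assoc[of "4*m"] by simp
qed

text \<open>Each block is the regular representation of a unit: column j is the product of the unit
  with the j-th element of the basis 1, s, x, s x. On F the elements 1, s suffice.\<close>

definition anosov_mat :: "nat \<Rightarrow> rat mat" where
  "anosov_mat r = block_mat r (\<lambda>i j. coord (lam_norm * basis_elem j) i) (\<lambda>m i j. coord (layer_unit m * basis_elem j) i)"

lemma anosov_mat_carrier [simp]: "anosov_mat r \<in> carrier_mat (lie_dim r) (lie_dim r)"
  by (simp add: anosov_mat_def)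

lemma coord_mult_basis_elem:
  assumes "k < 4"
  shows "coord (x * basis_elem 0) k * a + coord (x * basis_elem 1) k * b + coord (x * basis_elem 2) k * c
    + coord (x * basis_elem 3) k * d = coord (x * BQ a b c d) k"
  using assms by (cases rule: less4_cases) (simp_all add: coord_def basis_elem_def biquad_defs algebra_simps)

lemma anosov_mat_mult_index:
  assumes "u \<in> carrier_vec (lie_dim r)" "m < r" "k < 4" "i = 4*m+2+k"
  shows "(anosov_mat r *\<^sub>v u) $ i = coord (layer_unit m * comp_K r u m) k"
  unfolding anosov_mat_def block_mat_mult_K[OF assms] coord_mult_basis_elem[OF assms(3)] using assms(2)
  by (simp add: comp_K_def)

lemma anosov_mat_mult:
  assumes "u \<in> carrier_vec (lie_dim r)"
  shows "comp_F (anosov_mat r *\<^sub>v u) = lam_norm * comp_F u"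
    and "m < r \<Longrightarrow> comp_K r (anosov_mat r *\<^sub>v u) m = layer_unit m * comp_K r u m"
proof -
  show "comp_F (anosov_mat r *\<^sub>v u) = lam_norm * comp_F u"
    unfolding comp_F_def anosov_mat_def
    by (simp add: block_mat_mult_F[OF assms] coord_def basis_elem_def lam_norm_def biquad_defs)
next
  assume m: "m < r"
  note mult = anosov_mat_mult_index[OF assms m]
  have "(anosov_mat r *\<^sub>v u) $ (4*m+2) = coord (layer_unit m * comp_K r u m) 0"
    "(anosov_mat r *\<^sub>v u) $ (4*m+3) = coord (layer_unit m * comp_K r u m) 1"
    "(anosov_mat r *\<^sub>v u) $ (4*m+4) = coord (layer_unit m * comp_K r u m) 2"
    "(anosov_mat r *\<^sub>v u) $ (4*m+5) = coord (layer_unit m * comp_K r u m) 3"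
    by (rule mult; simp)+
  then show "comp_K r (anosov_mat r *\<^sub>v u) m = layer_unit m * comp_K r u m"
    unfolding comp_K_def[of r "anosov_mat r *\<^sub>v u"] biquad_eq_iff using m by (simp add: coord_def)
qed

lemma anosov_mat_bracket:
  assumes x: "x \<in> carrier_vec (lie_dim r)" and y: "y \<in> carrier_vec (lie_dim r)"
  shows "anosov_mat r *\<^sub>v bracket r x y = bracket r (anosov_mat r *\<^sub>v x) (anosov_mat r *\<^sub>v y)"
proof (rule comp_eqI[where r = r])
  have c0: "comp_K r (anosov_mat r *\<^sub>v v) 0 = lam * comp_K r v 0" if "v \<in> carrier_vec (lie_dim r)" for v
    using anosov_mat_mult(2)[OF that, of 0] by (cases "r = 0") (simp_all add: layer_unit_def comp_K_def)
  show "comp_F (anosov_mat r *\<^sub>v bracket r x y) = comp_F (bracket r (anosov_mat r *\<^sub>v x) (anosov_mat r *\<^sub>v y))"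
    by (simp add: anosov_mat_mult(1)[where r = r] comp_F_bracket c0 x y area_lam)
  fix m assume m: "m < r"
  \<comment> \<open>Going up one layer costs exactly one factor \<open>lam\<close>. For m = 1 the
    layer below is F, with multiplier \<open>lam_norm\<close>; for m = 0 both sides are 0.\<close>
  have p: "lam * prev_comp r (anosov_mat r *\<^sub>v v) m = layer_unit m * prev_comp r v m"
    if "v \<in> carrier_vec (lie_dim r)" for v
    using m that
    by (cases "(r, v, m)" rule: prev_comp.cases)
      (simp_all add: layer_unit_def anosov_mat_mult[where r = r] algebra_simps)
  have "comp_K r (anosov_mat r *\<^sub>v bracket r x y) m =
      comp_K r x 0 * (layer_unit m * prev_comp r y m) - comp_K r y 0 * (layer_unit m * prev_comp r x m)"
    using m by (simp add: anosov_mat_mult comp_K_bracket algebra_simps)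
  also have "\<dots> = comp_K r (bracket r (anosov_mat r *\<^sub>v x) (anosov_mat r *\<^sub>v y)) m"
    using m by (simp add: p[OF x, symmetric] p[OF y, symmetric] comp_K_bracket c0 x y algebra_simps)
  finally show "comp_K r (anosov_mat r *\<^sub>v bracket r x y) m = comp_K r (bracket r (anosov_mat r *\<^sub>v x) (anosov_mat r *\<^sub>v y)) m" .
qed (simp_all add: mult_mat_vec_carrier[OF anosov_mat_carrier])

section \<open>Integrality of the characteristic polynomial\<close>

definition integral :: "biquad \<Rightarrow> bool" where
  "integral x \<longleftrightarrow> q0 x \<in> \<int> \<and> q1 x \<in> \<int> \<and> q2 x \<in> \<int> \<and> q3 x \<in> \<int>"

lemma integral_mult: "integral x \<Longrightarrow> integral y \<Longrightarrow> integral (x * y)"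
  by (simp add: integral_def times_biquad_def)

lemma integral_layer_unit: "integral (layer_unit m)"
proof -
  have l: "integral lam" "integral lam_norm" "integral 1"
    by (simp_all add: integral_def lam_def lam_norm_def one_biquad_def)
  have "integral (lam ^ m)" for m
    by (induction m) (simp_all add: l integral_mult)
  then show ?thesis by (simp add: layer_unit_def l integral_mult)
qed

lemma integral_basis_elem: "integral (basis_elem j)"
  by (simp add: integral_def basis_elem_def)

lemma coord_integral: "integral x \<Longrightarrow> i < 4 \<Longrightarrow> coord x i \<in> \<int>"
  by (erule less4_cases) (simp_all add: integral_def coord_def)

lemma anosov_mat_entry_Ints:
  assumes "i < lie_dim r" "j < lie_dim r"
  shows "anosov_mat r $$ (i,j) \<in> \<int>"
proof -
  have "integral lam_norm" by (simp add: integral_def lam_norm_def)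
  then show ?thesis
    using assms
    by (auto simp: anosov_mat_def block_mat_def intro!: coord_integral integral_mult integral_layer_unit integral_basis_elem)
qed

text \<open>Entrywise \<open>floor\<close> lifts the matrix to an integer matrix, and characteristic
  polynomials commute with the ring homomorphism \<open>of_int\<close>.\<close>

lemma char_poly_coeff_Ints:
  fixes A :: "'a::{floor_ceiling,idom} mat"
  assumes A: "A \<in> carrier_mat n n" and "\<And>i j. i < n \<Longrightarrow> j < n \<Longrightarrow> A $$ (i,j) \<in> \<int>"
  shows "coeff (char_poly A) k \<in> \<int>"
proof -
  define B where "B = map_mat floor A"
  have B: "B \<in> carrier_mat n n" using A by (simp add: B_def)
  have "A = map_mat of_int B"
    by (rule eq_matI) (use assms in \<open>auto simp: B_def\<close>)
  then have "char_poly A = map_poly of_int (char_poly B)"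
    using of_int_hom.char_poly_hom[OF B] by simp
  then show ?thesis by simp
qed

section \<open>The eigenvalues\<close>

text \<open>Evaluation at s = p and x = q. When p and q are roots of the defining equations this is
  a real embedding of K.\<close>

definition embed :: "real \<Rightarrow> real \<Rightarrow> biquad \<Rightarrow> real" where
  "embed p q x = of_rat (q0 x) + of_rat (q1 x) * p + of_rat (q2 x) * q + of_rat (q3 x) * (p * q)"

lemma embed_mult:
  assumes "p * p = 2" "q * q = q + 1"
  shows "embed p q (x * y) = embed p q x * embed p q y"
proof -
  have s: "p * (p * z) = 2 * z" "q * (q * z) = q * z + z" for z
    using assms by (simp_all add: mult.assoc[symmetric] algebra_simps)
  show ?thesis
    unfolding embed_def times_biquad_def
    by (simp add: of_rat_add of_rat_mult algebra_simps assms s)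
qed

lemma embed_one: "embed p q 1 = 1"
  by (simp add: embed_def one_biquad_def)

lemma embed_power:
  assumes "p * p = 2" "q * q = q + 1"
  shows "embed p q (x ^ m) = embed p q x ^ m"
  by (induction m) (simp_all add: embed_one embed_mult[OF assms])

text \<open>Together with \<open>gold\<close>, the numbers k < 4 enumerate the four embeddings of K.
  The conjugates of \<open>lam\<close> are then about 3.29, 0.13, -1.29, 1.87, in this
  order.\<close>

definition rt2 :: "nat \<Rightarrow> real" where
  "rt2 k = (if k < 2 then sqrt 2 else - sqrt 2)"

definition gold :: "nat \<Rightarrow> real" where
  "gold k = (if even k then (1 + sqrt 5) / 2 else (1 - sqrt 5) / 2)"

lemma rt2_sq: "rt2 k * rt2 k = 2"
  by (simp add: rt2_def)

lemma gold_sq: "gold k * gold k = gold k + 1"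
  by (simp add: gold_def field_simps)

text \<open>Conjugates of the layer multipliers, ordered so that index i belongs to row i of
  \<open>diagonalizer\<close>.\<close>

definition eigval :: "nat \<Rightarrow> real" where
  "eigval i = (if i = 0 then sqrt 2 - 1 else if i = 1 then - sqrt 2 - 1
     else embed (rt2 ((i-2) mod 4)) (gold ((i-2) mod 4)) (layer_unit ((i-2) div 4)))"

lemma eigval_block:
  assumes "k < 4" "i = 4*m+2+k"
  shows "eigval i = (if m = 0 then 1 + rt2 k * gold k
    else (1 + rt2 k * gold k) ^ m * (rt2 k - 1))"
proof -
  have "\<not> i < 2" "(i-2) div 4 = m" "(i-2) mod 4 = k" using assms by auto
  then have "eigval i = embed (rt2 k) (gold k) (layer_unit m)" by (auto simp: eigval_def)
  moreover have "embed (rt2 k) (gold k) lam = 1 + rt2 k * gold k"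
    "embed (rt2 k) (gold k) lam_norm = rt2 k - 1"
    by (simp_all add: embed_def lam_def lam_norm_def)
  ultimately show ?thesis
    by (simp add: layer_unit_def embed_mult embed_power rt2_sq gold_sq)
qed

section \<open>Moduli and products of the conjugates\<close>

lemma sqrt_bounds: "1.41 < sqrt (2::real)" "sqrt (2::real) < 1.42" "2.23 < sqrt (5::real)"
    "sqrt (5::real) < 2.24"
  by (rule real_less_rsqrt real_less_lsqrt; simp add: power2_eq_square)+

text \<open>This index belongs to embedding 1, where the conjugates of \<open>lam\<close> (about
  0.13) and \<open>lam_norm\<close> (about 0.41) both lie strictly between 0 and 1.\<close>

lemma eigval_small:
  assumes "i = 4*m+3"
  shows "\<bar>eigval i\<bar> < 1"
proof -
  let ?l = "1 + rt2 1 * gold 1"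
  have "sqrt 2 * (sqrt 5 - 1) < 1.42 * 1.24" "0 < sqrt 2 * (sqrt 5 - 1)"
    using sqrt_bounds by (intro mult_strict_mono) auto
  moreover have "?l = 1 - sqrt 2 * (sqrt 5 - 1) / 2"
    by (simp add: rt2_def gold_def field_simps)
  ultimately have l: "0 < ?l" "?l < 1" by simp_all
  then have "?l ^ m \<le> 1" by (simp add: power_le_one)
  moreover have "rt2 1 - 1 < 1" "0 < rt2 1 - 1" using sqrt_bounds by (simp_all add: rt2_def)
  moreover from calculation have "?l ^ m * (rt2 1 - 1) \<le> 1 * (rt2 1 - 1)"
    by (intro mult_right_mono) simp_all
  ultimately have "?l ^ m * (rt2 1 - 1) < 1" unfolding mult_1 by (elim order.strict_trans1)
  moreover have "0 < ?l ^ m * (rt2 1 - 1)"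
    using l \<open>0 < rt2 1 - 1\<close> by simp
  moreover have "eigval i = (if m = 0 then ?l else ?l ^ m * (rt2 1 - 1))"
    by (rule eigval_block) (simp_all add: assms)
  ultimately show ?thesis using l by simp
qed

text \<open>With l and n the conjugates of \<open>lam\<close> and \<open>lam_norm\<close>, it
  suffices that l and l n exceed 1 in modulus, since l^m n = l^(m-1) (l n) for m > 0.\<close>

lemma eigval_large:
  assumes "k \<in> {0,2,3}" "i = 4*m+2+k"
  shows "\<bar>eigval i\<bar> > 1"
proof -
  let ?l = "1 + rt2 k * gold k"
  have "1.41 * 3.23 < sqrt 2 * (1 + sqrt 5)" "1.41 * 1.23 < sqrt 2 * (sqrt 5 - 1)"
    using sqrt_bounds by (intro mult_strict_mono; simp)+
  then have b: "9/2 < sqrt 2 * (1 + sqrt 5)" "17/10 < sqrt 2 * (sqrt 5 - 1)" by simp_all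
  \<comment> \<open>Here a and b are rational lower bounds for the two moduli. At k = 0 the factor b
    = 0.41 is below 1, but 3.2 * 0.41 > 1; at k = 2 and k = 3 the bounds 6/5 and 2 serve
    both.\<close>
  have "\<exists>a b. 1 < a \<and> 0 < b \<and> 1 < a * b \<and> a < \<bar>?l\<bar> \<and> b < \<bar>rt2 k - 1\<bar>"
  proof (cases "k = 0")
    case True
    then have "?l = 1 + sqrt 2 * (1 + sqrt 5) / 2" by (simp add: rt2_def gold_def)
    then have "16/5 < \<bar>?l\<bar>" using b by linarith
    moreover have "41/100 < \<bar>rt2 k - 1\<bar>" using sqrt_bounds True by (simp add: rt2_def)
    ultimately show ?thesis by (intro exI[of _ "16/5"] exI[of _ "41/100"]) simp
  next
    case False
    then have "?l = 1 - sqrt 2 * (1 + sqrt 5) / 2 \<or> ?l = 1 + sqrt 2 * (sqrt 5 - 1) / 2"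
      using assms by (auto simp: rt2_def gold_def field_simps)
    then have "6/5 < \<bar>?l\<bar>" using b by linarith
    moreover have "2 < \<bar>rt2 k - 1\<bar>" using sqrt_bounds False assms by (auto simp: rt2_def)
    ultimately show ?thesis by (intro exI[of _ "6/5"] exI[of _ 2]) simp
  qed
  then obtain a b where ab: "1 < a" "0 < b" "1 < a * b" "a < \<bar>?l\<bar>" "b < \<bar>rt2 k - 1\<bar>"
    by blast
  then have "a * b < \<bar>?l\<bar> * \<bar>rt2 k - 1\<bar>" by (intro mult_strict_mono) auto
  with ab have l: "1 < \<bar>?l\<bar>" and ln: "1 < \<bar>?l\<bar> * \<bar>rt2 k - 1\<bar>" by linarith+
  have e: "eigval i = (if m = 0 then ?l else ?l ^ m * (rt2 k - 1))"
    by (rule eigval_block) (use assms in auto)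
  show ?thesis
  proof (cases m)
    case 0
    then show ?thesis using e l by simp
  next
    case (Suc n)
    have "1 \<le> \<bar>?l\<bar> ^ n" using l by (simp add: one_le_power)
    then have "1 * (\<bar>?l\<bar> * \<bar>rt2 k - 1\<bar>) \<le> \<bar>?l\<bar> ^ n * (\<bar>?l\<bar> * \<bar>rt2 k - 1\<bar>)"
      by (rule mult_right_mono) simp
    also have "\<dots> = \<bar>eigval i\<bar>" using e Suc by (simp add: abs_mult power_abs)
    finally show ?thesis using ln by simp
  qed
qed

text \<open>The product is the norm of \<open>layer_unit m\<close> from K to the rationals. The norm
  of \<open>lam\<close> is (sqrt 2 - 1)(-sqrt 2 - 1) = -1, and that of \<open>lam_norm\<close> is
  (-1)^2 = 1.\<close>

lemma eigval_block_prod: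
  "\<bar>eigval (4*m+2) * eigval (4*m+3) * eigval (4*m+4) * eigval (4*m+5)\<bar> = 1"
proof -
  have e: "eigval (4*m+2+k) = (if m = 0 then 1 + rt2 k * gold k
    else (1 + rt2 k * gold k) ^ m * (rt2 k - 1))" if "k < 4" for k
    by (rule eigval_block[OF that refl])
  \<comment> \<open>The two embeddings over a fixed sign of sqrt 2 multiply to the conjugate of the
    relative norm.\<close>
  have g: "(1 + rt2 0 * gold 0) * (1 + rt2 1 * gold 1) = sqrt 2 - 1"
    "(1 + rt2 2 * gold 2) * (1 + rt2 3 * gold 3) = - sqrt 2 - 1"
    by (simp_all add: rt2_def gold_def field_simps)
  have s: "(sqrt 2 - 1) * (- sqrt 2 - 1) = (-1::real)" by (simp add: algebra_simps)
  let ?l = "\<lambda>k. 1 + rt2 k * gold k"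
  have l: "?l 0 * ?l 1 * ?l 2 * ?l 3 = -1"
    using g s by (metis mult.assoc)
  have n: "(rt2 0 - 1) * (rt2 1 - 1) * (rt2 2 - 1) * (rt2 3 - 1) = 1"
    by (simp add: rt2_def algebra_simps)
  have "eigval (4*m+2+0) * eigval (4*m+2+1) * eigval (4*m+2+2) * eigval (4*m+2+3) =
    (if m = 0 then ?l 0 * ?l 1 * ?l 2 * ?l 3 else (?l 0 * ?l 1 * ?l 2 * ?l 3) ^ m *
      ((rt2 0 - 1) * (rt2 1 - 1) * (rt2 2 - 1) * (rt2 3 - 1)))"
    by (subst e, simp)+ (simp add: power_mult_distrib mult_ac)
  also have "\<bar>\<dots>\<bar> = 1" unfolding l n by (simp add: power_abs)
  finally show ?thesis unfolding add.assoc[of "4*m"] by simp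
qed

lemma upt_lie_dim_Suc: "[0..<lie_dim (Suc r)] = [0..<lie_dim r] @ [4*r+2, 4*r+3, 4*r+4, 4*r+5]"
  by (simp add: lie_dim_def eval_nat_numeral)

lemma upt_lie_dim_0: "[0..<lie_dim 0] = [0, 1]"
  by (simp add: lie_dim_def eval_nat_numeral)

text \<open>The layer F contributes one eigenvalue to either count; each block adds one small and
  three large ones.\<close>

lemma eigval_count:
  "length (filter (\<lambda>i. \<bar>eigval i\<bar> < 1) [0..<lie_dim r]) = r + 1"
  "length (filter (\<lambda>i. \<bar>eigval i\<bar> > 1) [0..<lie_dim r]) = 3 * r + 1"
proof -
  have b: "\<bar>eigval 0\<bar> < 1" "\<bar>eigval 1\<bar> > 1" using sqrt_bounds by (simp_all add: eigval_def)
  have e: "\<bar>eigval (4*r+2)\<bar> > 1" "\<bar>eigval (4*r+3)\<bar> < 1" "\<bar>eigval (4*r+4)\<bar> > 1" "\<bar>eigval (4*r+5)\<bar> > 1" for r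
    using eigval_large[of 0 "4*r+2" r] eigval_large[of 2 "4*r+4" r] eigval_large[of 3 "4*r+5" r]
      eigval_small[of "4*r+3" r] by simp_all
  show "length (filter (\<lambda>i. \<bar>eigval i\<bar> < 1) [0..<lie_dim r]) = r + 1"
  proof (induction r)
    case 0
    then show ?case using b b[THEN less_not_sym] by (simp add: upt_lie_dim_0)
  next
    case (Suc r)
    then show ?case using e[of r] e[of r, THEN less_not_sym]
      unfolding upt_lie_dim_Suc filter_append length_append filter.simps by simp
  qed
  show "length (filter (\<lambda>i. \<bar>eigval i\<bar> > 1) [0..<lie_dim r]) = 3 * r + 1"
  proof (induction r)
    case 0
    then show ?case using b b[THEN less_not_sym] by (simp add: upt_lie_dim_0)
  next
    case (Suc r)
    then show ?case using e[of r] e[of r, THEN less_not_sym]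
      unfolding upt_lie_dim_Suc filter_append length_append filter.simps by simp
  qed
qed

lemma eigval_prod: "\<bar>prod_list (map eigval [0..<lie_dim r])\<bar> = 1"
proof (induction r)
  case 0
  have "eigval 0 * eigval 1 = -1" by (simp add: eigval_def algebra_simps)
  then show ?case by (simp add: upt_lie_dim_0)
next
  case (Suc r)
  then show ?case using eigval_block_prod[of r]
    unfolding upt_lie_dim_Suc by (simp add: abs_mult mult.assoc)
qed

lemma eigval_abs_neq_1:
  assumes "i < lie_dim r"
  shows "\<bar>eigval i\<bar> \<noteq> 1"
  using assms
proof (cases rule: block_index_cases)
  case (3 m k)
  show ?thesis
  proof (cases "k = 1")
    case True
    then have "\<bar>eigval i\<bar> < 1" using 3 by (intro eigval_small[of _ m]) simp
    then show ?thesis by simp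
  next
    case False
    then have "\<bar>eigval i\<bar> > 1" using 3 by (intro eigval_large[of k _ m]) auto
    then show ?thesis by simp
  qed
qed (use sqrt_bounds in \<open>simp_all add: eigval_def\<close>)

section \<open>Diagonalization over the reals\<close>

definition diagonalizer :: "nat \<Rightarrow> real mat" where
  "diagonalizer r = block_mat r (\<lambda>i j. if j = 0 then 1 else if i = 0 then sqrt 2 else - sqrt 2)
     (\<lambda>m i j. [1, rt2 i, gold i, rt2 i * gold i] ! j)"

lemma diagonalizer_carrier [simp]: "diagonalizer r \<in> carrier_mat (lie_dim r) (lie_dim r)"
  by (simp add: diagonalizer_def)

lemma diagonalizer_mult:
  assumes "u \<in> carrier_vec (lie_dim r)"
  shows "(diagonalizer r *\<^sub>v u) $ 0 = u $ 0 + sqrt 2 * u $ 1"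
    and "(diagonalizer r *\<^sub>v u) $ 1 = u $ 0 - sqrt 2 * u $ 1"
    and "m < r \<Longrightarrow> k < 4 \<Longrightarrow> i = 4*m+2+k \<Longrightarrow> (diagonalizer r *\<^sub>v u) $ i =
      u $ (4*m+2) + rt2 k * u $ (4*m+3) + gold k * u $ (4*m+4) + rt2 k * gold k * u $ (4*m+5)"
  unfolding diagonalizer_def
  by (simp_all add: block_mat_mult_F[OF assms] block_mat_mult_K[OF assms])

text \<open>The rows of \<open>diagonalizer\<close> are the embeddings evaluated on the basis, so it
  sends a rational vector to the conjugates of its components. On F the value \<open>q\<close> of x
  is arbitrary.\<close>

lemma diagonalizer_mult_rat:
  assumes "v \<in> carrier_vec (lie_dim r)"
  shows "(diagonalizer r *\<^sub>v map_vec of_rat v) $ 0 = embed (sqrt 2) q (comp_F v)"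
    and "(diagonalizer r *\<^sub>v map_vec of_rat v) $ 1 = embed (- sqrt 2) q (comp_F v)"
    and "m < r \<Longrightarrow> k < 4 \<Longrightarrow> i = 4*m+2+k \<Longrightarrow>
      (diagonalizer r *\<^sub>v map_vec of_rat v) $ i = embed (rt2 k) (gold k) (comp_K r v m)"
proof -
  have u: "map_vec of_rat v \<in> carrier_vec (lie_dim r)" using assms by simp
  have d: "0 < dim_vec v" "1 < dim_vec v" using assms by (auto simp: lie_dim_def)
  show "(diagonalizer r *\<^sub>v map_vec of_rat v) $ 0 = embed (sqrt 2) q (comp_F v)"
    "(diagonalizer r *\<^sub>v map_vec of_rat v) $ 1 = embed (- sqrt 2) q (comp_F v)"
    unfolding diagonalizer_mult[OF u] using d by (simp_all add: embed_def comp_F_def)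
  assume m: "m < r" and k: "k < 4" and i: "i = 4*m+2+k"
  have "4*m+2 < dim_vec v" "4*m+3 < dim_vec v" "4*m+4 < dim_vec v" "4*m+5 < dim_vec v"
    using m assms by (auto simp: lie_dim_def)
  with m show "(diagonalizer r *\<^sub>v map_vec of_rat v) $ i = embed (rt2 k) (gold k) (comp_K r v m)"
    unfolding diagonalizer_mult(3)[OF u m k i] by (simp add: embed_def comp_K_def mult.commute)
qed

text \<open>Embeddings are multiplicative, so multiplication by a unit becomes scaling by its
  conjugate.\<close>

lemma diagonalizer_anosov_mat_vec:
  assumes v: "v \<in> carrier_vec (lie_dim r)" and i: "i < lie_dim r"
  shows "(diagonalizer r *\<^sub>v map_vec of_rat (anosov_mat r *\<^sub>v v)) $ i =
    eigval i * (diagonalizer r *\<^sub>v map_vec of_rat v) $ i"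
proof -
  have av: "anosov_mat r *\<^sub>v v \<in> carrier_vec (lie_dim r)"
    using v by (rule mult_mat_vec_carrier[OF anosov_mat_carrier])
  \<comment> \<open>\<open>embed_mult\<close> requires a root of x^2 = x + 1; \<open>gold 0\<close>
    is one choice.\<close>
  have F: "embed p (gold 0) (lam_norm * comp_F v) = (p - 1) * embed p (gold 0) (comp_F v)" if "p * p = 2" for p
    by (simp add: embed_mult[OF that gold_sq]) (simp add: embed_def lam_norm_def)
  from i show ?thesis
  proof (cases rule: block_index_cases)
    case 1
    then show ?thesis
      by (simp add: diagonalizer_mult_rat(1)[OF v, of "gold 0"] F eigval_def anosov_mat_mult(1)[OF v]
        diagonalizer_mult_rat(1)[OF av, of "gold 0"])
  next
    case 2
    have "(diagonalizer r *\<^sub>v map_vec of_rat (anosov_mat r *\<^sub>v v)) $ 1 =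
        eigval 1 * (diagonalizer r *\<^sub>v map_vec of_rat v) $ 1"
      unfolding diagonalizer_mult_rat(2)[OF v, of "gold 0"]
        diagonalizer_mult_rat(2)[OF av, of "gold 0"] anosov_mat_mult(1)[OF v]
      by (simp add: F eigval_def)
    with 2 show ?thesis by simp
  next
    case (3 m k)
    have "\<not> i < 2" "(i-2) div 4 = m" "(i-2) mod 4 = k" using 3 by auto
    then have "eigval i = embed (rt2 k) (gold k) (layer_unit m)" by (auto simp: eigval_def)
    then show ?thesis
      using 3 by (simp only: diagonalizer_mult_rat(3)[OF v] diagonalizer_mult_rat(3)[OF av]
        anosov_mat_mult(2)[OF v] embed_mult[OF rt2_sq gold_sq])
  qed
qed

text \<open>Unit vectors are rational, so the identity on rational vectors already determines every
  column.\<close>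

lemma diagonalizer_anosov_mat:
  "diagonalizer r * map_mat of_rat (anosov_mat r) = mat_diag (lie_dim r) eigval * diagonalizer r"
proof (rule eq_matI)
  fix i j assume "i < dim_row (mat_diag (lie_dim r) eigval * diagonalizer r)"
    "j < dim_col (mat_diag (lie_dim r) eigval * diagonalizer r)"
  then have i: "i < lie_dim r" and j: "j < lie_dim r"
    using mat_diag_dim[of "lie_dim r" eigval] diagonalizer_carrier[of r] by auto
  let ?e = "unit_vec (lie_dim r) j :: rat vec"
  have e: "map_vec of_rat ?e = (unit_vec (lie_dim r) j :: real vec)"
    by (rule eq_vecI) (simp_all add: unit_vec_def)
  have c: "A *\<^sub>v unit_vec (lie_dim r) j = col A j" if "A \<in> carrier_mat (lie_dim r) (lie_dim r)"
    for A :: "'a::comm_ring_1 mat"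
    using that j by (intro eq_vecI) (auto simp: scalar_prod_right_unit)
  have "(diagonalizer r * map_mat of_rat (anosov_mat r)) $$ (i,j) =
      (diagonalizer r *\<^sub>v col (map_mat of_rat (anosov_mat r)) j) $ i"
    using i j
    by (simp add: carrier_matD[OF diagonalizer_carrier] carrier_matD[OF anosov_mat_carrier])
  also have "col (map_mat of_rat (anosov_mat r)) j = map_vec of_rat (anosov_mat r *\<^sub>v ?e)"
    unfolding c[OF anosov_mat_carrier]
    by (rule eq_vecI) (use j in \<open>simp_all add: carrier_matD[OF anosov_mat_carrier]\<close>)
  also have "(diagonalizer r *\<^sub>v \<dots>) $ i = eigval i * (diagonalizer r *\<^sub>v unit_vec (lie_dim r) j) $ i"
    using diagonalizer_anosov_mat_vec[OF _ i, of ?e] e by simp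
  also have "\<dots> = eigval i * diagonalizer r $$ (i,j)"
    using i j unfolding c[OF diagonalizer_carrier]
    by (simp add: carrier_matD[OF diagonalizer_carrier])
  also have "\<dots> = (mat_diag (lie_dim r) eigval * diagonalizer r) $$ (i,j)"
    using i j by (simp add: mat_diag_mult_left[OF diagonalizer_carrier])
  finally show "(diagonalizer r * map_mat of_rat (anosov_mat r)) $$ (i,j) =
    (mat_diag (lie_dim r) eigval * diagonalizer r) $$ (i,j)" .
qed (simp_all add: carrier_matD[OF diagonalizer_carrier] carrier_matD[OF mat_diag_dim]
    carrier_matD[OF anosov_mat_carrier])

text \<open>A kernel vector is killed in two stages: first the signs of sqrt 2 are separated, then
  the two golden roots, each time by a 2 x 2 Vandermonde system.\<close>

lemma diagonalizer_det: "det (diagonalizer r) \<noteq> 0"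
proof
  assume "det (diagonalizer r) = 0"
  then obtain u where u: "u \<in> carrier_vec (lie_dim r)" "u \<noteq> 0\<^sub>v (lie_dim r)"
    and z: "diagonalizer r *\<^sub>v u = 0\<^sub>v (lie_dim r)"
    using det_0_iff_vec_prod_zero[OF diagonalizer_carrier] by blast
  have split: "x = 0 \<and> y = 0" if "x + sqrt 2 * y = 0" "x - sqrt 2 * y = 0" for x y :: real
    using that by auto
  have "u $ i = 0" if "i < lie_dim r" for i
    using that
  proof (cases rule: block_index_cases)
    case (3 m k)
    let ?a = "u $ (4*m+2)" and ?b = "u $ (4*m+3)" and ?c = "u $ (4*m+4)" and ?d = "u $ (4*m+5)"
    have eq: "?a + rt2 k * ?b + gold k * ?c + rt2 k * gold k * ?d = 0" if k: "k < 4" for k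
    proof -
      have "4*m+2+k < lie_dim r" using 3(1) k by (simp add: lie_dim_def)
      then show ?thesis
        using diagonalizer_mult(3)[OF u(1) 3(1) k refl] by (simp only: z index_zero_vec)
    qed
    have g: "rt2 0 = sqrt 2" "rt2 1 = sqrt 2" "rt2 2 = - sqrt 2" "rt2 3 = - sqrt 2"
      "gold 2 = gold 0" "gold 3 = gold 1"
      by (simp_all add: rt2_def gold_def)
    \<comment> \<open>Rows 0 and 2 share \<open>gold 0\<close> and differ only in the sign of sqrt
      2; below, rows 1 and 3 do the same with \<open>gold 1\<close>.\<close>
    have "?a + gold 0 * ?c = 0 \<and> ?b + gold 0 * ?d = 0"
      using eq[of 0] eq[of 2] unfolding g by (intro split) (simp_all add: algebra_simps)
    moreover have "?a + gold 1 * ?c = 0 \<and> ?b + gold 1 * ?d = 0"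
      using eq[of 1] eq[of 3] unfolding g by (intro split) (simp_all add: algebra_simps)
    moreover have "x = 0 \<and> y = 0" if "x + gold 0 * y = 0" "x + gold 1 * y = 0" for x y
    proof -
      have "(gold 0 - gold 1) * y = 0" unfolding left_diff_distrib using that by linarith
      moreover have "gold 0 \<noteq> gold 1" by (simp add: gold_def)
      ultimately show ?thesis using that(1) by auto
    qed
    ultimately have "?a = 0" "?b = 0" "?c = 0" "?d = 0" by blast+
    moreover have "i = 4*m+2 \<or> i = 4*m+3 \<or> i = 4*m+4 \<or> i = 4*m+5" using 3 by linarith
    ultimately show ?thesis by metis
  qed (use split[of "u $ 0" "u $ 1"] diagonalizer_mult(1,2)[OF u(1)] z in
    \<open>simp_all add: lie_dim_def\<close>)
  then have "u = 0\<^sub>v (lie_dim r)" using u(1) by (intro eq_vecI) auto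
  with u(2) show False by simp
qed

lemma similar_anosov_mat: "similar_mat (map_mat of_rat (anosov_mat r)) (mat_diag (lie_dim r) eigval)"
proof -
  let ?A = "map_mat of_rat (anosov_mat r) :: real mat" and ?W = "diagonalizer r"
    and ?D = "mat_diag (lie_dim r) eigval"
  have A: "?A \<in> carrier_mat (lie_dim r) (lie_dim r)" and D: "?D \<in> carrier_mat (lie_dim r) (lie_dim r)"
    using anosov_mat_carrier[of r] by simp_all
  obtain V where V: "V \<in> carrier_mat (lie_dim r) (lie_dim r)"
    and inv: "V * ?W = 1\<^sub>m (lie_dim r)" "?W * V = 1\<^sub>m (lie_dim r)"
    using det_non_zero_imp_unit[OF diagonalizer_carrier diagonalizer_det, of r "()"]
    unfolding Units_def ring_mat_def by auto
  have "?A = V * ?W * ?A" unfolding inv left_mult_one_mat[OF A] ..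
  also have "\<dots> = V * (?W * ?A)" using V A by (simp add: assoc_mult_mat[OF V diagonalizer_carrier A])
  also have "\<dots> = V * (?D * ?W)" by (simp only: diagonalizer_anosov_mat)
  also have "\<dots> = V * ?D * ?W" using assoc_mult_mat[OF V D diagonalizer_carrier] by simp
  finally have "similar_mat_wit ?A ?D V ?W"
    using A D V inv unfolding similar_mat_wit_def Let_def by auto
  then show ?thesis unfolding similar_mat_def by blast
qed

section \<open>The spectrum, the determinant and the conclusion\<close>

lemma diag_mat_mat_diag: "diag_mat (mat_diag n f) = map f [0..<n]"
  by (rule nth_equalityI) (simp_all add: diag_mat_def mat_diag_def)

lemma upper_triangular_mat_diag: "upper_triangular (mat_diag n f)"
  by (auto simp: mat_diag_def)

lemma complex_of_real_of_rat: "complex_of_real (of_rat q) = of_rat q"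
  by (cases q) (simp add: of_rat_rat)

lemma proots_prod_linear:
  "proots (\<Prod>x\<leftarrow>xs. [:- f x, 1:]) = mset (map (f :: 'b \<Rightarrow> 'a::idom) xs)"
proof (induction xs)
  case (Cons x xs)
  have "(\<Prod>x\<leftarrow>xs. [:- f x, 1:]) \<noteq> 0" by (auto simp: prod_list_zero_iff)
  then have "proots ([:- f x, 1:] * (\<Prod>x\<leftarrow>xs. [:- f x, 1:])) =
      {#f x#} + proots (\<Prod>x\<leftarrow>xs. [:- f x, 1:])"
    by (subst proots_mult) simp_all
  with Cons show ?case by (simp only: list.map prod_list.Cons mset.simps) simp
qed simp

text \<open>The similarity holds over the reals, so the characteristic polynomial is split there and
  the factorization is then carried to the complex numbers.\<close>

lemma eigenvalues_anosov_mat: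
  "eigenvalues_C (anosov_mat r) = mset (map (\<lambda>i. complex_of_real (eigval i)) [0..<lie_dim r])"
proof -
  interpret h: map_poly_comm_ring_hom "of_real :: real \<Rightarrow> complex" ..
  have "map_poly of_rat (char_poly (anosov_mat r)) = char_poly (map_mat of_rat (anosov_mat r) :: real mat)"
    by (rule of_rat_hom.char_poly_hom[OF anosov_mat_carrier, symmetric])
  also have "\<dots> = char_poly (mat_diag (lie_dim r) eigval)"
    by (rule char_poly_similar[OF similar_anosov_mat])
  also have "\<dots> = (\<Prod>i\<leftarrow>[0..<lie_dim r]. [:- eigval i, 1:])"
    by (simp add: char_poly_upper_triangular[OF mat_diag_dim upper_triangular_mat_diag]
      diag_mat_mat_diag comp_def)
  finally have R: "map_poly of_rat (char_poly (anosov_mat r)) = (\<Prod>i\<leftarrow>[0..<lie_dim r]. [:- eigval i, 1:])" .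
  have "map_poly (of_rat :: rat \<Rightarrow> complex) (char_poly (anosov_mat r)) =
      map_poly of_real (map_poly of_rat (char_poly (anosov_mat r)))"
    by (simp add: map_poly_map_poly comp_def complex_of_real_of_rat)
  also have "\<dots> = (\<Prod>i\<leftarrow>[0..<lie_dim r]. [:- complex_of_real (eigval i), 1:])"
    unfolding R h.hom_prod_list by (simp add: comp_def)
  finally show ?thesis
    unfolding eigenvalues_C_def
    by (simp only: proots_prod_linear)
qed

lemma det_anosov_mat: "det (anosov_mat r) = 1 \<or> det (anosov_mat r) = -1"
proof -
  have "real_of_rat (det (anosov_mat r)) = det (map_mat of_rat (anosov_mat r) :: real mat)"
    by simp
  also have "\<dots> = det (mat_diag (lie_dim r) eigval)" by (rule det_similar[OF similar_anosov_mat])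
  also have "\<dots> = prod_list (map eigval [0..<lie_dim r])"
    using det_upper_triangular[OF upper_triangular_mat_diag mat_diag_dim]
    by (simp add: diag_mat_mat_diag)
  finally have "\<bar>real_of_rat (det (anosov_mat r))\<bar> = 1" using eigval_prod by simp
  then have "of_rat (det (anosov_mat r)) = (of_rat 1 :: real) \<or> of_rat (det (anosov_mat r)) = (of_rat (-1) :: real)"
    by (auto simp: abs_if split: if_splits)
  then show ?thesis unfolding of_rat_eq_iff .
qed

theorem theorem3p5:
  fixes c :: nat
  assumes "c \<ge> 1"
  shows "\<exists>n br A. lie_algebra n br \<and> nilpotency_class n br c \<and> anosov_aut n br A \<and>
           Min (signature A) = c"
proof -
  \<comment> \<open>With r copies of K the class is r + 1.\<close>
  obtain r where c: "c = Suc r" using assms by (cases c) auto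
  have "lie_automorphism (lie_dim r) (bracket r) (anosov_mat r)"
    using det_anosov_mat[of r] anosov_mat_bracket unfolding lie_automorphism_def by auto
  moreover have "hyperbolic (anosov_mat r)"
    using eigval_abs_neq_1[of _ r] by (auto simp: hyperbolic_def eigenvalues_anosov_mat)
  moreover have "integer_like (anosov_mat r)"
    using det_anosov_mat char_poly_coeff_Ints[OF anosov_mat_carrier anosov_mat_entry_Ints]
    unfolding integer_like_def by blast
  \<comment> \<open>The minimum is r + 1 = c; for r = 0 the two entries coincide.\<close>
  moreover have "signature (anosov_mat r) = {r + 1, 3 * r + 1}"
    unfolding signature_def eigenvalues_anosov_mat mset_filter[symmetric] size_mset filter_map length_map
    using eigval_count[of r] by (simp add: comp_def)
  ultimately show ?thesis
    using bracket_lie_algebra bracket_nilpotency_class c unfolding anosov_aut_def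
    by (intro exI[of _ "lie_dim r"] exI[of _ "bracket r"] exI[of _ "anosov_mat r"]) simp
qed

end
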